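(* A quadrilateral lattice $\mathbf{x}$ in $\mathbb{P}^M$ ($M\ge2$) is a Koenigs lattice if and only if, at every point of $\mathbb{Z}^2$, the three lines $L_{\mathbf{x}_{-1}\mathbf{x}_{1(11)}}$, $L_{\mathbf{x}_{1}\mathbf{x}_{-1(22)}}$ and $L_{\mathbf{x}\,\mathbf{x}_{(12)}}$ intersect in a single point. Here $L_{\mathbf{a}\mathbf{b}}$ denotes the line through the points $\mathbf{a}$ and $\mathbf{b}$.
   Context: Notation: for a function $g$ on $\mathbb{Z}^2$, $g_{(1)}(n_1,n_2)=g(n_1+1,n_2)$, $g_{(2)}(n_1,n_2)=g(n_1,n_2+1)$, $g_{(12)}(n_1,n_2)=g(n_1+1,n_2+1)$, $g_{(11)}(n_1,n_2)=g(n_1+2,n_2)$, $g_{(22)}(n_1,n_2)=g(n_1,n_2+2)$. A quadrilateral lattice in $\mathbb{P}^M=\mathbb{P}(\mathbb{R}^{M+1})$ is a map $\mathbb{Z}^2\to\mathbb{P}^M$ whose elementary quadrilaterals $\mathbf{x},\mathbf{x}_{(1)},\mathbf{x}_{(2)},\mathbf{x}_{(12)}$ are planar; in homogeneous coordinates $\mathbf{x}:\mathbb{Z}^2\to\mathbb{R}^{M+1}\setminus\{0\}$ it satisfies the discrete Laplace equation $\mathbf{x}_{(12)}=A_{(1)}\mathbf{x}_{(1)}+B_{(2)}\mathbf{x}_{(2)}+C\mathbf{x}$ with functions $A,B,C$ on $\mathbb{Z}^2$. Its Laplace transforms are the lattices $\mathbf{x}_1=\mathbf{x}_{(2)}-A\mathbf{x}$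 and $\mathbf{x}_{-1}=\mathbf{x}_{(1)}-B\mathbf{x}$. The six points $\mathbf{x}_1,\mathbf{x}_{1(1)},\mathbf{x}_{1(11)},\mathbf{x}_{-1},\mathbf{x}_{-1(2)},\mathbf{x}_{-1(22)}$ lie in the plane of the elementary quadrilateral $\mathbf{x},\mathbf{x}_{(1)},\mathbf{x}_{(2)},\mathbf{x}_{(12)}$. A Koenigs lattice is a quadrilateral lattice such that for every point of it there exists a conic (possibly degenerate) in that plane passing through these six points. Genericity convention: at every point of $\mathbb{Z}^2$ the vectors $\mathbf{x},\mathbf{x}_{(1)},\mathbf{x}_{(2)}$ are linearly independent, $A,B,C$ are nonzero, and $A_{(1)}B+C\neq0$, $B_{(2)}A+C\neq0$ (so that no three of $\mathbf{x}_1,\mathbf{x}_{1(1)},\mathbf{x}_{-1},\mathbf{x}_{-1(2)}$ are collinear). *)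

theory Defs imports "HOL-Analysis.Analysis" begin

section \<open>Real projective geometry in homogeneous coordinates\<close>

text \<open>Points of the projective space of a subspace \<open>W\<close> are its one-dimensional linear subspaces;
  the projective space of \<open>R\<^sup>n\<close> is \<open>projectivization UNIV\<close>.\<close>

definition projectivization :: "(real^'n) set \<Rightarrow> (real^'n) set set" where
  "projectivization W = {p. subspace p \<and> dim p = 1 \<and> p \<subseteq> W}"

text \<open>The point with homogeneous coordinates \<open>v\<close>; it is a point of the projective space only
  for \<open>v \<noteq> 0\<close>.\<close>

definition hpoint :: "real^'n \<Rightarrow> (real^'n) set" where
  "hpoint v = span {v}"

definition proj_line :: "(real^'n) set \<Rightarrow> (real^'n) set \<Rightarrow> (real^'n) set set" where
  "proj_line p q = projectivization (span (p \<union> q))"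

text \<open>A conic of the projective plane of \<open>W\<close> is the zero locus of a quadratic form that is not
  identically zero on \<open>W\<close>. Since the form may have any nonzero rank, degenerate conics (line pairs,
  double lines) are included. The form is given on the whole space, which loses nothing because
  every quadratic form on \<open>W\<close> extends.\<close>

definition conic_in :: "(real^'n) set \<Rightarrow> (real^'n) set set \<Rightarrow> bool" where
  "conic_in W K \<longleftrightarrow>
    (\<exists>\<beta> :: real^'n \<Rightarrow> real^'n \<Rightarrow> real. bilinear \<beta> \<and> (\<exists>w\<in>W. \<beta> w w \<noteq> 0) \<and>
       K = {p \<in> projectivization W. \<forall>v\<in>p. \<beta> v v = 0})"


section \<open>Lattices\<close>

text \<open>For a function \<open>g\<close> on the integer lattice, \<open>sh1 g\<close> is \<open>g\<close> with subscript (1) and \<open>sh2 g\<close> is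
  \<open>g\<close> with subscript (2); the subscripts (11), (22), (12) are compositions of these.\<close>

definition sh1 :: "(int \<Rightarrow> int \<Rightarrow> 'a) \<Rightarrow> int \<Rightarrow> int \<Rightarrow> 'a" where
  "sh1 g n1 n2 = g (n1 + 1) n2"

definition sh2 :: "(int \<Rightarrow> int \<Rightarrow> 'a) \<Rightarrow> int \<Rightarrow> int \<Rightarrow> 'a" where
  "sh2 g n1 n2 = g n1 (n2 + 1)"

definition quad_span :: "(int \<Rightarrow> int \<Rightarrow> real^'n) \<Rightarrow> int \<Rightarrow> int \<Rightarrow> (real^'n) set" where
  "quad_span x n1 n2 = span {x n1 n2, sh1 x n1 n2, sh2 x n1 n2, sh1 (sh2 x) n1 n2}"

text \<open>A lattice in projective space is given by homogeneous coordinates \<open>x\<close>.\<close>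

definition quadrilateral_lattice :: "(int \<Rightarrow> int \<Rightarrow> real^'n) \<Rightarrow> bool" where
  "quadrilateral_lattice x \<longleftrightarrow>
    (\<forall>n1 n2. x n1 n2 \<noteq> 0) \<and>
    (\<forall>n1 n2. \<exists>W. subspace W \<and> dim W = 3 \<and>
       {hpoint (x n1 n2), hpoint (sh1 x n1 n2), hpoint (sh2 x n1 n2), hpoint (sh1 (sh2 x) n1 n2)}
         \<subseteq> projectivization W)"

definition discrete_laplace ::
    "(int \<Rightarrow> int \<Rightarrow> real^'n) \<Rightarrow> (int \<Rightarrow> int \<Rightarrow> real) \<Rightarrow> (int \<Rightarrow> int \<Rightarrow> real) \<Rightarrow> (int \<Rightarrow> int \<Rightarrow> real) \<Rightarrow> bool"
  where
  "discrete_laplace x A B C \<longleftrightarrow>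
    (\<forall>n1 n2. sh1 (sh2 x) n1 n2 =
       sh1 A n1 n2 *\<^sub>R sh1 x n1 n2 + sh2 B n1 n2 *\<^sub>R sh2 x n1 n2 + C n1 n2 *\<^sub>R x n1 n2)"

text \<open>Distinctness is required separately because \<open>independent\<close> is about sets and would ignore
  repetitions.\<close>

definition generic_lattice ::
    "(int \<Rightarrow> int \<Rightarrow> real^'n) \<Rightarrow> (int \<Rightarrow> int \<Rightarrow> real) \<Rightarrow> (int \<Rightarrow> int \<Rightarrow> real) \<Rightarrow> (int \<Rightarrow> int \<Rightarrow> real) \<Rightarrow> bool"
  where
  "generic_lattice x A B C \<longleftrightarrow>
    (\<forall>n1 n2.
       distinct [x n1 n2, sh1 x n1 n2, sh2 x n1 n2] \<and>
       independent {x n1 n2, sh1 x n1 n2, sh2 x n1 n2} \<and>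
       A n1 n2 \<noteq> 0 \<and> B n1 n2 \<noteq> 0 \<and> C n1 n2 \<noteq> 0 \<and>
       sh1 A n1 n2 * B n1 n2 + C n1 n2 \<noteq> 0 \<and>
       sh2 B n1 n2 * A n1 n2 + C n1 n2 \<noteq> 0)"

text \<open>The Laplace transforms: \<open>laplace_pos A x\<close> is the lattice with index \<open>1\<close>, \<open>laplace_neg B x\<close> the
  one with index \<open>-1\<close>.\<close>

definition laplace_pos ::
    "(int \<Rightarrow> int \<Rightarrow> real) \<Rightarrow> (int \<Rightarrow> int \<Rightarrow> real^'n) \<Rightarrow> int \<Rightarrow> int \<Rightarrow> real^'n" where
  "laplace_pos A x n1 n2 = sh2 x n1 n2 - A n1 n2 *\<^sub>R x n1 n2"

definition laplace_neg ::
    "(int \<Rightarrow> int \<Rightarrow> real) \<Rightarrow> (int \<Rightarrow> int \<Rightarrow> real^'n) \<Rightarrow> int \<Rightarrow> int \<Rightarrow> real^'n" where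
  "laplace_neg B x n1 n2 = sh1 x n1 n2 - B n1 n2 *\<^sub>R x n1 n2"

text \<open>For a generic lattice the coefficients are determined by \<open>x\<close>, so carrying them as parameters
  involves no choice.\<close>

definition koenigs_lattice ::
    "(int \<Rightarrow> int \<Rightarrow> real^'n) \<Rightarrow> (int \<Rightarrow> int \<Rightarrow> real) \<Rightarrow> (int \<Rightarrow> int \<Rightarrow> real) \<Rightarrow> (int \<Rightarrow> int \<Rightarrow> real) \<Rightarrow> bool"
  where
  "koenigs_lattice x A B C \<longleftrightarrow>
    quadrilateral_lattice x \<and> discrete_laplace x A B C \<and>
    (\<forall>n1 n2. \<exists>K. conic_in (quad_span x n1 n2) K \<and>
       {hpoint (laplace_pos A x n1 n2),
        hpoint (sh1 (laplace_pos A x) n1 n2),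
        hpoint (sh1 (sh1 (laplace_pos A x)) n1 n2),
        hpoint (laplace_neg B x n1 n2),
        hpoint (sh2 (laplace_neg B x) n1 n2),
        hpoint (sh2 (sh2 (laplace_neg B x)) n1 n2)} \<subseteq> K)"

end

theory Submission imports Defs begin

text \<open>In the frame \<open>x, x\<^sub>(\<^sub>1\<^sub>), x\<^sub>(\<^sub>2\<^sub>)\<close> of the plane, both conditions become the same scalar
  equation \<open>A\<^sub>(\<^sub>1\<^sub>2\<^sub>) B C\<^sub>(\<^sub>1\<^sub>) = B\<^sub>(\<^sub>1\<^sub>2\<^sub>) A C\<^sub>(\<^sub>2\<^sub>)\<close>.
  For the lines: \<open>x\<^sub>1\<^sub>(\<^sub>1\<^sub>1\<^sub>) - C\<^sub>(\<^sub>1\<^sub>) x\<^sub>-\<^sub>1 = B\<^sub>(\<^sub>1\<^sub>2\<^sub>) x\<^sub>(\<^sub>1\<^sub>2\<^sub>) + B C\<^sub>(\<^sub>1\<^sub>) x\<close> is the intersection point of the first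
  line with the diagonal, and symmetrically for the second line. For the conic: the forms vanishing
  at \<open>x\<^sub>1, x\<^sub>1\<^sub>(\<^sub>1\<^sub>), x\<^sub>-\<^sub>1, x\<^sub>-\<^sub>1\<^sub>(\<^sub>2\<^sub>)\<close> form a pencil, and each of the two remaining points singles out one
  member of it.\<close>

section \<open>Projective points, lines and conics in terms of spanning vectors\<close>

lemma mem_span_pair: "v \<in> span {u, w} \<longleftrightarrow> (\<exists>s t. v = s *\<^sub>R u + t *\<^sub>R w)"
  unfolding span_insert span_singleton
  by (auto simp: algebra_simps)

text \<open>Subtracting the \<open>r\<close> part of a common vector leaves a multiple of
  \<open>u\<close> inside \<open>span {w, r}\<close>, so that multiple is zero. Later
  \<open>r\<close> is the known meeting point of two lines.\<close>

lemma span_pair_Int: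
  assumes "u \<notin> span {w, r}"
  shows "span {u, r} \<inter> span {w, r} = span {r}"
proof
  show "span {u, r} \<inter> span {w, r} \<subseteq> span {r}"
  proof
    fix v assume v: "v \<in> span {u, r} \<inter> span {w, r}"
    then obtain s t where st: "v = s *\<^sub>R u + t *\<^sub>R r" by (auto simp: mem_span_pair)
    have "v - t *\<^sub>R r \<in> span {w, r}"
      using v by (auto intro: span_diff span_scale span_base)
    then have "s *\<^sub>R u \<in> span {w, r}" using st by simp
    then have "s = 0"
      using assms span_scale[of "s *\<^sub>R u" "{w, r}" "inverse s"] by (cases "s = 0") auto
    then show "v \<in> span {r}" using st by (auto intro: span_scale span_base)
  qed
  show "span {r} \<subseteq> span {u, r} \<inter> span {w, r}"
    by (simp add: span_mono)
qed

text \<open>Serves to replace one of the two points spanning a line by another point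
  \<open>r\<close> of that line.\<close>

lemma span_pair_shear:
  assumes "r = s *\<^sub>R u + t *\<^sub>R w" "t \<noteq> 0"
  shows "span {u, r} = span {u, w}"
proof -
  have "w = (1 / t) *\<^sub>R r + (- s / t) *\<^sub>R u" using assms by (simp add: algebra_simps)
  then have "w \<in> span {u, r}" by (metis mem_span_pair add.commute)
  moreover have "r \<in> span {u, w}" using assms mem_span_pair by blast
  ultimately show ?thesis
    by (intro subset_antisym span_minimal) (auto intro: span_base)
qed

lemma proj_line_hpoint: "proj_line (hpoint u) (hpoint v) = projectivization (span {u, v})"
proof -
  have "span (span {u} \<union> span {v}) = span ({u} \<union> {v})"
    by (simp only: span_Un span_span)
  then show ?thesis by (simp add: proj_line_def hpoint_def insert_commute)
qed

lemma projectivization_Int: "projectivization U \<inter> projectivization V = projectivization (U \<inter> V)"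
  by (auto simp: projectivization_def)

lemma hpoint_in_projectivization:
  assumes "subspace W"
  shows "hpoint v \<in> projectivization W \<longleftrightarrow> v \<noteq> 0 \<and> v \<in> W"
proof -
  have "span {v} \<subseteq> W \<longleftrightarrow> v \<in> W"
    using assms span_base[of v "{v}"] span_minimal[of "{v}" W] by blast
  then show ?thesis by (simp add: projectivization_def hpoint_def dim_insert)
qed

lemma projectivization_span_singleton:
  assumes "v \<noteq> 0"
  shows "projectivization (span {v}) = {hpoint v}"
proof -
  have "p = span {v}" if "subspace p" "dim p = 1" "p \<subseteq> span {v}" for p
    using that subspace_dim_equal[of p "span {v}"] assms by (simp add: dim_insert)
  moreover have "hpoint v \<in> projectivization (span {v})"
    using assms by (simp add: hpoint_in_projectivization span_base)
  ultimately show ?thesis by (auto simp: projectivization_def hpoint_def)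
qed

text \<open>Both sets are singletons, so they are disjoint or equal; concurrency thereby becomes
  equality of two points.\<close>

lemma projectivization_lines_Int:
  assumes "r \<noteq> 0" "s \<noteq> 0"
  shows "(\<exists>p. projectivization (span {r}) \<inter> projectivization (span {s}) = {p}) \<longleftrightarrow> span {r} = span {s}"
  unfolding projectivization_span_singleton[OF assms(1)] projectivization_span_singleton[OF assms(2)]
  by (auto simp: hpoint_def)

text \<open>By homogeneity a form vanishes on a whole one-dimensional subspace once it vanishes at a
  spanning vector.\<close>

lemma conic_through_iff:
  fixes W :: "(real^'n) set"
  assumes "subspace W"
  shows "(\<exists>K. conic_in W K \<and> hpoint ` S \<subseteq> K) \<longleftrightarrow>
    (\<exists>f :: real^'n \<Rightarrow> real^'n \<Rightarrow> real. bilinear f \<and> (\<exists>w\<in>W. f w w \<noteq> 0) \<and> (\<forall>v\<in>S. v \<noteq> 0 \<and> v \<in> W \<and> f v v = 0))"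
proof -
  have *: "(\<forall>u\<in>hpoint v. f u u = 0) \<longleftrightarrow> f v v = 0"
    if "bilinear f" for f :: "real^'n \<Rightarrow> real^'n \<Rightarrow> real" and v
    using that unfolding hpoint_def span_singleton
    by (auto simp: bilinear_lmul bilinear_rmul)
  have "hpoint ` S \<subseteq> {p \<in> projectivization W. \<forall>u\<in>p. f u u = 0} \<longleftrightarrow>
      (\<forall>v\<in>S. v \<noteq> 0 \<and> v \<in> W \<and> f v v = 0)" if "bilinear f" for f :: "real^'n \<Rightarrow> real^'n \<Rightarrow> real"
    using hpoint_in_projectivization[OF assms] *[OF that] by (auto simp: image_subset_iff)
  then show ?thesis unfolding conic_in_def by blast
qed

section \<open>Scalar equations for the coefficients of a conic through the six points\<close>

text \<open>The two points with \<open>Y = 0\<close> and the two with \<open>Z = 0\<close> express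
  all coefficients except \<open>s12\<close> through \<open>q00\<close>. Each remaining point then
  yields an equation for \<open>s12\<close>; comparing the two gives the claim.\<close>

lemma conic_coefficients_imp:
  fixes a b c a1 b2 \<alpha> \<beta> c1 c2 q00 q11 q22 s01 s02 s12 :: real
  defines "Q \<equiv> \<lambda>X Y Z. X\<^sup>2 * q00 + Y\<^sup>2 * q11 + Z\<^sup>2 * q22 + X * Y * s01 + X * Z * s02 + Y * Z * s12"
  assumes nz: "a \<noteq> 0" "b \<noteq> 0" "c \<noteq> 0" "a1 \<noteq> 0" "b2 \<noteq> 0" "\<alpha> \<noteq> 0" "\<beta> \<noteq> 0"
    and gen: "a1 * b + c \<noteq> 0" "b2 * a + c \<noteq> 0" "\<beta> * a1 + c1 \<noteq> 0" "\<alpha> * b2 + c2 \<noteq> 0"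
    and P: "Q (- a) 0 1 = 0" "Q c 0 b2 = 0" "Q (\<beta> * c) (\<beta> * a1 + c1) (\<beta> * b2) = 0"
    and N: "Q (- b) 1 0 = 0" "Q c a1 0 = 0" "Q (\<alpha> * c) (\<alpha> * a1) (\<alpha> * b2 + c2) = 0"
    and Q: "Q X Y Z \<noteq> 0"
  shows "\<alpha> * b * c1 = \<beta> * a * c2"
proof -
  have P': "a\<^sup>2 * q00 + q22 - a * s02 = 0" "c\<^sup>2 * q00 + b2\<^sup>2 * q22 + c * b2 * s02 = 0"
    and N': "b\<^sup>2 * q00 + q11 - b * s01 = 0" "c\<^sup>2 * q00 + a1\<^sup>2 * q11 + c * a1 * s01 = 0"
    using P N by (simp_all add: Q_def)
  \<comment> \<open>Elimination of \<open>s02\<close> from \<open>P'\<close>. The factor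
    \<open>b2 * a + c\<close> is, up to sign, the determinant of the two points on the line
    \<open>Y = 0\<close>.\<close>
  have "(b2 * a + c) * (b2 * q22 + a * c * q00) = 0"
    using P' by algebra
  then have q22: "b2 * q22 = - a * c * q00" using gen by simp
  have "(a1 * b + c) * (a1 * q11 + b * c * q00) = 0"
    using N' by algebra
  then have q11: "a1 * q11 = - b * c * q00" using gen by simp
  have "a * (b2 * s02 - q00 * (a * b2 - c)) = 0"
    using P'(1) q22 by algebra
  then have s02: "b2 * s02 = q00 * (a * b2 - c)" using nz by simp
  have "b * (a1 * s01 - q00 * (b * a1 - c)) = 0"
    using N'(1) q11 by algebra
  then have s01: "a1 * s01 = q00 * (b * a1 - c)" using nz by simp
  \<comment> \<open>The third point is \<open>\<beta>\<close> times \<open>(c, 0, b2)\<close> plus a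
    multiple of \<open>(0, 1, 0)\<close>. Since \<open>Q\<close> vanishes at
    \<open>(c, 0, b2)\<close>, every surviving term contains the factor \<open>Y\<close>.\<close>
  have "(\<beta> * a1 + c1) * ((\<beta> * a1 + c1) * q11 + \<beta> * c * s01 + \<beta> * b2 * s12) = 0"
    using P'(2) P(3) unfolding Q_def by algebra
  then have "(\<beta> * a1 + c1) * q11 + \<beta> * c * s01 + \<beta> * b2 * s12 = 0" using gen by simp
  then have P3: "\<beta> * (a1 * b2 * s12 - c\<^sup>2 * q00) = b * c * c1 * q00"
    using q11 s01 by algebra
  have "(\<alpha> * b2 + c2) * ((\<alpha> * b2 + c2) * q22 + \<alpha> * c * s02 + \<alpha> * a1 * s12) = 0"
    using N'(2) N(3) unfolding Q_def by algebra
  then have "(\<alpha> * b2 + c2) * q22 + \<alpha> * c * s02 + \<alpha> * a1 * s12 = 0" using gen by simp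
  then have N3: "\<alpha> * (a1 * b2 * s12 - c\<^sup>2 * q00) = a * c * c2 * q00"
    using q22 s02 by algebra
  \<comment> \<open>All coefficients are governed by \<open>q00\<close>, so \<open>q00 = 0\<close>
    would make the form vanish identically.\<close>
  have "q00 \<noteq> 0"
  proof
    assume "q00 = 0"
    then have "q11 = 0" "q22 = 0" "s01 = 0" "s02 = 0" "s12 = 0"
      using q11 q22 s01 s02 P3 nz by auto
    with \<open>q00 = 0\<close> show False using Q by (simp add: Q_def)
  qed
  moreover have "(c * q00) * (\<alpha> * b * c1 - \<beta> * a * c2) = 0"
    using P3 N3 by algebra
  ultimately show ?thesis using nz by simp
qed

lemma conic_coefficients_exist:
  fixes a b c a1 b2 \<alpha> \<beta> c1 c2 :: real
  assumes nz: "a1 \<noteq> 0" "b2 \<noteq> 0" "\<beta> \<noteq> 0"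
    and eq: "\<alpha> * b * c1 = \<beta> * a * c2"
  obtains q00 q11 q22 s01 s02 s12 where "q00 \<noteq> 0"
    "\<And>X Y Z. (X, Y, Z) \<in> {(- a, 0, 1), (c, 0, b2), (\<beta> * c, \<beta> * a1 + c1, \<beta> * b2),
        (- b, 1, 0), (c, a1, 0), (\<alpha> * c, \<alpha> * a1, \<alpha> * b2 + c2)} \<Longrightarrow>
      X\<^sup>2 * q00 + Y\<^sup>2 * q11 + Z\<^sup>2 * q22 + X * Y * s01 + X * Z * s02 + Y * Z * s12 = 0"
proof -
  \<comment> \<open>By \<open>eq\<close>, this one number solves both conditions on
    \<open>s12\<close>, those from the third and the sixth point.\<close>
  define t where "t = b * c1 / \<beta>"
  have t: "\<beta> * t = b * c1" "\<alpha> * t = a * c2"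
    using nz eq by (auto simp: t_def field_simps)
  show ?thesis
  \<comment> \<open>These are the values forced in the converse direction, normalised by
    \<open>q00 = a1 * b2\<close> to clear denominators.\<close>
  proof (rule that[of "a1 * b2" "- b * c * b2" "- a * c * a1" "b2 * (b * a1 - c)" "a1 * (a * b2 - c)"
        "c\<^sup>2 + c * t"])
    show "a1 * b2 \<noteq> 0" using nz by simp
    fix X Y Z
    assume "(X, Y, Z) \<in> {(- a, 0, 1), (c, 0, b2), (\<beta> * c, \<beta> * a1 + c1, \<beta> * b2),
        (- b, 1, 0), (c, a1, 0), (\<alpha> * c, \<alpha> * a1, \<alpha> * b2 + c2)}"
    then show "X\<^sup>2 * (a1 * b2) + Y\<^sup>2 * (- b * c * b2) + Z\<^sup>2 * (- a * c * a1) +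
        X * Y * (b2 * (b * a1 - c)) + X * Z * (a1 * (a * b2 - c)) + Y * Z * (c\<^sup>2 + c * t) = 0"
    \<comment> \<open>Only the third and sixth points can have \<open>Y * Z\<close> nonzero, so only
      they involve \<open>t\<close>.\<close>
    proof (elim insertE emptyE Pair_inject, goal_cases)
      case 3
      then show ?case using t by (simp only:) algebra
    next
      case 6
      then show ?case using t by (simp only:) algebra
    qed (simp_all add: algebra_simps power2_eq_square)
  qed
qed

section \<open>Coordinates in a frame of the plane of the quadrilateral\<close>

locale plane_frame =
  fixes e0 e1 e2 :: "real^'n"
  assumes dist: "distinct [e0, e1, e2]" and indep: "independent {e0, e1, e2}"
begin

definition pt :: "real \<Rightarrow> real \<Rightarrow> real \<Rightarrow> real^'n" where
  "pt X Y Z = X *\<^sub>R e0 + Y *\<^sub>R e1 + Z *\<^sub>R e2"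

lemma pt_scale: "s *\<^sub>R pt X Y Z = pt (s * X) (s * Y) (s * Z)"
  by (simp add: pt_def algebra_simps)

lemma pt_add: "pt X Y Z + pt X' Y' Z' = pt (X + X') (Y + Y') (Z + Z')"
  by (simp add: pt_def algebra_simps)

lemma span_frame: "span {e0, e1, e2} = {pt X Y Z |X Y Z. True}"
proof -
  have "v \<in> span {e0, e1, e2} \<longleftrightarrow> (\<exists>X Y Z. v = pt X Y Z)" for v
    unfolding span_insert[of e0] mem_Collect_eq mem_span_pair pt_def
    by (simp only: diff_eq_eq add_ac)
  then show ?thesis by auto
qed

text \<open>The dual basis of the frame, extended linearly to the whole space because conics are
  given by forms defined there.\<close>

lemma coordinates:
  obtains l0 l1 l2 :: "real^'n \<Rightarrow> real" where "linear l0" "linear l1" "linear l2"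
    "\<And>X Y Z. l0 (pt X Y Z) = X" "\<And>X Y Z. l1 (pt X Y Z) = Y" "\<And>X Y Z. l2 (pt X Y Z) = Z"
proof -
  have "\<exists>l::real^'n \<Rightarrow> real. linear l \<and> (\<forall>u\<in>{e0, e1, e2}. l u = (if u = e then 1 else 0))" for e
    by (rule linear_independent_extend[OF indep])
  then obtain l :: "real^'n \<Rightarrow> real^'n \<Rightarrow> real" where
    l: "\<And>e. linear (l e)" "\<And>e u. u \<in> {e0, e1, e2} \<Longrightarrow> l e u = (if u = e then 1 else 0)"
    by metis
  have "l e (pt X Y Z) = X * l e e0 + Y * l e e1 + Z * l e e2" for e X Y Z
    by (simp add: pt_def linear_add[OF l(1)] linear_scale[OF l(1)])
  then show ?thesis
    using dist by (intro that[of "l e0" "l e1" "l e2"]) (auto simp: l)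
qed

lemma pt_eq_iff [simp]: "pt X Y Z = pt X' Y' Z' \<longleftrightarrow> X = X' \<and> Y = Y' \<and> Z = Z'"
  by (metis coordinates)

lemma pt_eq_0_iff [simp]: "pt X Y Z = 0 \<longleftrightarrow> X = 0 \<and> Y = 0 \<and> Z = 0"
proof -
  have "pt 0 0 0 = 0" by (simp add: pt_def)
  then show ?thesis by (metis pt_eq_iff)
qed

lemma bilinear_pt:
  assumes "bilinear f"
  shows "f (pt X Y Z) (pt X Y Z) = X\<^sup>2 * f e0 e0 + Y\<^sup>2 * f e1 e1 + Z\<^sup>2 * f e2 e2 +
    X * Y * (f e0 e1 + f e1 e0) + X * Z * (f e0 e2 + f e2 e0) + Y * Z * (f e1 e2 + f e2 e1)"
  using assms
  by (simp add: pt_def bilinear_ladd bilinear_radd bilinear_lmul bilinear_rmul algebra_simps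
      power2_eq_square)

lemma quadratic_form_exists:
  obtains f :: "real^'n \<Rightarrow> real^'n \<Rightarrow> real" where "bilinear f"
    "\<And>X Y Z. f (pt X Y Z) (pt X Y Z) =
      X\<^sup>2 * q00 + Y\<^sup>2 * q11 + Z\<^sup>2 * q22 + X * Y * s01 + X * Z * s02 + Y * Z * s12"
proof -
  obtain l0 l1 l2 :: "real^'n \<Rightarrow> real" where l: "linear l0" "linear l1" "linear l2"
    "\<And>X Y Z. l0 (pt X Y Z) = X" "\<And>X Y Z. l1 (pt X Y Z) = Y" "\<And>X Y Z. l2 (pt X Y Z) = Z"
    using coordinates by blast
  \<comment> \<open>Only the values \<open>f u u\<close> matter, so \<open>f\<close> need not be
    symmetric and each mixed coefficient is placed in a single entry.\<close>
  define f where "f u v = q00 * l0 u * l0 v + q11 * l1 u * l1 v + q22 * l2 u * l2 v +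
    s01 * l0 u * l1 v + s02 * l0 u * l2 v + s12 * l1 u * l2 v" for u v
  have "bilinear f"
    unfolding bilinear_def linear_iff f_def
    by (simp add: l(1-3)[THEN linear_add] l(1-3)[THEN linear_scale] algebra_simps)
  then show ?thesis
    by (rule that) (simp add: f_def l power2_eq_square algebra_simps)
qed

text \<open>\<open>a1\<close>, \<open>b2\<close>, \<open>c1\<close>, \<open>c2\<close>, \<open>\<alpha>\<close>, \<open>\<beta>\<close> stand for \<open>A\<^sub>(\<^sub>1\<^sub>)\<close>, \<open>B\<^sub>(\<^sub>2\<^sub>)\<close>, \<open>C\<^sub>(\<^sub>1\<^sub>)\<close>, \<open>C\<^sub>(\<^sub>2\<^sub>)\<close>, \<open>A\<^sub>(\<^sub>1\<^sub>2\<^sub>)\<close>, \<open>B\<^sub>(\<^sub>1\<^sub>2\<^sub>)\<close>.\<close>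

lemma conic_through_six_points_iff:
  assumes nz: "a \<noteq> 0" "b \<noteq> 0" "c \<noteq> 0" "a1 \<noteq> 0" "b2 \<noteq> 0" "\<alpha> \<noteq> 0" "\<beta> \<noteq> 0"
    and gen: "a1 * b + c \<noteq> 0" "b2 * a + c \<noteq> 0" "\<beta> * a1 + c1 \<noteq> 0" "\<alpha> * b2 + c2 \<noteq> 0"
  shows "(\<exists>K. conic_in (span {e0, e1, e2}) K \<and>
      {hpoint (pt (- a) 0 1), hpoint (pt c 0 b2), hpoint (pt (\<beta> * c) (\<beta> * a1 + c1) (\<beta> * b2)),
       hpoint (pt (- b) 1 0), hpoint (pt c a1 0), hpoint (pt (\<alpha> * c) (\<alpha> * a1) (\<alpha> * b2 + c2))} \<subseteq> K)
    \<longleftrightarrow> \<alpha> * b * c1 = \<beta> * a * c2" (is "?L \<longleftrightarrow> ?R")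
proof -
  define T where "T = {(- a, 0, 1), (c, 0, b2), (\<beta> * c, \<beta> * a1 + c1, \<beta> * b2),
      (- b, 1, 0), (c, a1, 0), (\<alpha> * c, \<alpha> * a1, \<alpha> * b2 + c2)}"
  define S where "S = (\<lambda>(X, Y, Z). pt X Y Z) ` T"
  have "hpoint ` S = {hpoint (pt (- a) 0 1), hpoint (pt c 0 b2),
      hpoint (pt (\<beta> * c) (\<beta> * a1 + c1) (\<beta> * b2)), hpoint (pt (- b) 1 0), hpoint (pt c a1 0),
      hpoint (pt (\<alpha> * c) (\<alpha> * a1) (\<alpha> * b2 + c2))}"
    unfolding S_def T_def by (simp only: image_insert image_empty prod.case)
  then have L: "?L \<longleftrightarrow> (\<exists>f :: real^'n \<Rightarrow> real^'n \<Rightarrow> real.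
      bilinear f \<and> (\<exists>w\<in>span {e0, e1, e2}. f w w \<noteq> 0) \<and>
      (\<forall>v\<in>S. v \<noteq> 0 \<and> v \<in> span {e0, e1, e2} \<and> f v v = 0))"
    using conic_through_iff[OF subspace_span, of "{e0, e1, e2}" S] by (simp only:)
  show ?thesis
  proof
    assume ?L
    then obtain f :: "real^'n \<Rightarrow> real^'n \<Rightarrow> real" and w where f: "bilinear f"
        "w \<in> span {e0, e1, e2}" "f w w \<noteq> 0" "\<And>v. v \<in> S \<Longrightarrow> f v v = 0"
      unfolding L by blast
    obtain X Y Z where "w = pt X Y Z"
      using f(2) unfolding span_frame mem_Collect_eq by (elim exE conjE)
    with f(3) have w: "f (pt X Y Z) (pt X Y Z) \<noteq> 0" by simp
    have on: "f (pt X Y Z) (pt X Y Z) = 0" if "(X, Y, Z) \<in> T" for X Y Z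
      using f(4) that unfolding S_def by force
    show ?R
      \<comment> \<open>One copy of \<open>on\<close> for each of the six points; membership in
        \<open>T\<close> is left to the final simplification.\<close>
      by (rule conic_coefficients_imp[OF nz gen
            on[unfolded T_def bilinear_pt[OF f(1)]] on[unfolded T_def bilinear_pt[OF f(1)]]
            on[unfolded T_def bilinear_pt[OF f(1)]] on[unfolded T_def bilinear_pt[OF f(1)]]
            on[unfolded T_def bilinear_pt[OF f(1)]] on[unfolded T_def bilinear_pt[OF f(1)]]
            w[unfolded bilinear_pt[OF f(1)]]]) simp_all
  next
    assume ?R
    obtain q00 q11 q22 s01 s02 s12 where q: "q00 \<noteq> 0"
      "\<And>X Y Z. (X, Y, Z) \<in> T \<Longrightarrow>
        X\<^sup>2 * q00 + Y\<^sup>2 * q11 + Z\<^sup>2 * q22 + X * Y * s01 + X * Z * s02 + Y * Z * s12 = 0"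
      by (rule conic_coefficients_exist[OF nz(4,5,7) \<open>?R\<close>, of c, folded T_def]) (rule that; blast)
    obtain f :: "real^'n \<Rightarrow> real^'n \<Rightarrow> real" where f: "bilinear f" "\<And>X Y Z. f (pt X Y Z) (pt X Y Z) =
        X\<^sup>2 * q00 + Y\<^sup>2 * q11 + Z\<^sup>2 * q22 + X * Y * s01 + X * Z * s02 + Y * Z * s12"
      by (rule quadratic_form_exists[of q00 q11 q22 s01 s02 s12]) (erule that, simp only:)
    \<comment> \<open>The lattice point itself has value \<open>q00\<close> and so witnesses that
      the form is nonzero on the plane.\<close>
    have "f (pt 1 0 0) (pt 1 0 0) \<noteq> 0" using q(1) by (simp add: f)
    moreover have "pt 1 0 0 \<in> span {e0, e1, e2}" unfolding span_frame by blast
    moreover have "v \<noteq> 0 \<and> v \<in> span {e0, e1, e2} \<and> f v v = 0" if "v \<in> S" for v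
    proof -
      from that obtain X Y Z where v: "v = pt X Y Z" "(X, Y, Z) \<in> T" by (auto simp: S_def)
      have "f v v = 0" using f(2) q(2) v by simp
      moreover have "v \<noteq> 0" using v nz by (auto simp: T_def)
      moreover have "v \<in> span {e0, e1, e2}" using v(1) unfolding span_frame by blast
      ultimately show ?thesis by blast
    qed
    ultimately show ?L unfolding L using f(1) by blast
  qed
qed

lemma lines_concurrent_iff:
  assumes nz: "a1 \<noteq> 0" "b2 \<noteq> 0" "\<alpha> \<noteq> 0" "\<beta> \<noteq> 0"
  shows "(\<exists>p. proj_line (hpoint (pt (- b) 1 0)) (hpoint (pt (\<beta> * c) (\<beta> * a1 + c1) (\<beta> * b2))) \<inter>
      proj_line (hpoint (pt (- a) 0 1)) (hpoint (pt (\<alpha> * c) (\<alpha> * a1) (\<alpha> * b2 + c2))) \<inter>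
      proj_line (hpoint (pt 1 0 0)) (hpoint (pt c a1 b2)) = {p})
    \<longleftrightarrow> \<alpha> * b * c1 = \<beta> * a * c2"
proof -
  \<comment> \<open>\<open>R\<close> and \<open>S\<close> will be the points where the first and the
    second line meet the diagonal \<open>?D\<close>.\<close>
  define R where "R = pt (\<beta> * c + c1 * b) (\<beta> * a1) (\<beta> * b2)"
  define S where "S = pt (\<alpha> * c + c2 * a) (\<alpha> * a1) (\<alpha> * b2)"
  let ?L1 = "span {pt (- b) 1 0, pt (\<beta> * c) (\<beta> * a1 + c1) (\<beta> * b2)}"
  let ?L2 = "span {pt (- a) 0 1, pt (\<alpha> * c) (\<alpha> * a1) (\<alpha> * b2 + c2)}"
  let ?D = "span {pt 1 0 0, pt c a1 b2}"
  have DR: "span {pt 1 0 0, R} = ?D"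
    by (rule span_pair_shear[of _ "c1 * b" _ \<beta>]) (use nz in \<open>simp_all add: R_def pt_scale pt_add\<close>)
  have DS: "span {pt 1 0 0, S} = ?D"
    by (rule span_pair_shear[of _ "c2 * a" _ \<alpha>]) (use nz in \<open>simp_all add: S_def pt_scale pt_add\<close>)
  have "?L1 = span {pt (- b) 1 0, R}"
    by (rule span_pair_shear[symmetric, of _ "- c1" _ 1]) (simp_all add: R_def pt_scale pt_add)
  \<comment> \<open>On the diagonal the last two coordinates are proportional to
    \<open>(a1, b2)\<close>, and \<open>b2\<close> is nonzero.\<close>
  moreover have "pt (- b) 1 0 \<notin> ?D"
    using nz by (auto simp: mem_span_pair pt_scale pt_add)
  ultimately have L1: "?L1 \<inter> ?D = span {R}"
    using span_pair_Int DR by metis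
  have "?L2 = span {pt (- a) 0 1, S}"
    by (rule span_pair_shear[symmetric, of _ "- c2" _ 1]) (simp_all add: S_def pt_scale pt_add)
  moreover have "pt (- a) 0 1 \<notin> ?D"
    using nz by (auto simp: mem_span_pair pt_scale pt_add)
  ultimately have L2: "?L2 \<inter> ?D = span {S}"
    using span_pair_Int DS by metis
  \<comment> \<open>Intersecting with the diagonal twice changes nothing, so the triple intersection
    is that of \<open>?L1 \<inter> ?D\<close> and \<open>?L2 \<inter> ?D\<close>.\<close>
  have lines: "projectivization ?L1 \<inter> projectivization ?L2 \<inter> projectivization ?D =
      projectivization (span {R}) \<inter> projectivization (span {S})"
    unfolding L1[symmetric] L2[symmetric] projectivization_Int by (simp add: Int_ac)
  have "R \<noteq> 0" "S \<noteq> 0" using nz by (simp_all add: R_def S_def)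
  have "span {R} = span {S} \<longleftrightarrow> \<alpha> * b * c1 = \<beta> * a * c2"
  proof
    assume "span {R} = span {S}"
    then have "R \<in> span {S}" using span_base[of R "{R}"] by simp
    then obtain k where "R = k *\<^sub>R S" by (auto simp: span_singleton)
    then have k: "\<beta> * c + c1 * b = k * (\<alpha> * c + c2 * a)" "\<beta> * b2 = k * (\<alpha> * b2)"
      by (auto simp: R_def S_def pt_scale)
    \<comment> \<open>The third coordinate fixes the ratio \<open>k\<close>; the first one then
      carries the condition.\<close>
    from k(2) nz have "\<beta> = k * \<alpha>" by simp
    with k(1) show "\<alpha> * b * c1 = \<beta> * a * c2" by algebra
  next
    assume eq: "\<alpha> * b * c1 = \<beta> * a * c2"
    have "R = (\<beta> / \<alpha>) *\<^sub>R S"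
      using nz eq by (simp add: R_def S_def pt_scale field_simps)
    moreover from this have "S = (\<alpha> / \<beta>) *\<^sub>R R" using nz by simp
    ultimately have "R \<in> span {S}" "S \<in> span {R}"
      by (metis span_base span_scale insertI1)+
    then show "span {R} = span {S}"
      by (intro subset_antisym span_minimal) auto
  qed
  then show ?thesis
    unfolding proj_line_hpoint lines
    using projectivization_lines_Int[OF \<open>R \<noteq> 0\<close> \<open>S \<noteq> 0\<close>] by simp
qed

end

section \<open>Frame coordinates of the lattice points and of the Laplace transforms\<close>

theorem proposition2p2:
  fixes x :: "int \<Rightarrow> int \<Rightarrow> real^'n"
    and A B C :: "int \<Rightarrow> int \<Rightarrow> real"
    and M :: nat
  assumes "CARD('n) = M + 1" and "M \<ge> 2"
    and "quadrilateral_lattice x"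
    and "discrete_laplace x A B C"
    and "generic_lattice x A B C"
  shows "koenigs_lattice x A B C \<longleftrightarrow>
    (\<forall>n1 n2. \<exists>p.
       proj_line (hpoint (laplace_neg B x n1 n2)) (hpoint (sh1 (sh1 (laplace_pos A x)) n1 n2)) \<inter>
       proj_line (hpoint (laplace_pos A x n1 n2)) (hpoint (sh2 (sh2 (laplace_neg B x)) n1 n2)) \<inter>
       proj_line (hpoint (x n1 n2)) (hpoint (sh1 (sh2 x) n1 n2)) = {p})"
proof -
  have iff: "(\<exists>K. conic_in (quad_span x n1 n2) K \<and>
       {hpoint (laplace_pos A x n1 n2),
        hpoint (sh1 (laplace_pos A x) n1 n2),
        hpoint (sh1 (sh1 (laplace_pos A x)) n1 n2),
        hpoint (laplace_neg B x n1 n2),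
        hpoint (sh2 (laplace_neg B x) n1 n2),
        hpoint (sh2 (sh2 (laplace_neg B x)) n1 n2)} \<subseteq> K) \<longleftrightarrow>
    (\<exists>p.
       proj_line (hpoint (laplace_neg B x n1 n2)) (hpoint (sh1 (sh1 (laplace_pos A x)) n1 n2)) \<inter>
       proj_line (hpoint (laplace_pos A x n1 n2)) (hpoint (sh2 (sh2 (laplace_neg B x)) n1 n2)) \<inter>
       proj_line (hpoint (x n1 n2)) (hpoint (sh1 (sh2 x) n1 n2)) = {p})" for n1 n2
  proof -
    have gen: "distinct [x m k, x (m + 1) k, x m (k + 1)]"
        "independent {x m k, x (m + 1) k, x m (k + 1)}"
        "A m k \<noteq> 0" "B m k \<noteq> 0" "C m k \<noteq> 0"
        "A (m + 1) k * B m k + C m k \<noteq> 0" "B m (k + 1) * A m k + C m k \<noteq> 0" for m k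
      using assms(5) unfolding generic_lattice_def sh1_def sh2_def by blast+
    have lap: "x (m + 1) (k + 1) = A (m + 1) k *\<^sub>R x (m + 1) k + B m (k + 1) *\<^sub>R x m (k + 1) +
        C m k *\<^sub>R x m k" for m k
      using assms(4) unfolding discrete_laplace_def sh1_def sh2_def by blast
    interpret plane_frame "x n1 n2" "x (n1 + 1) n2" "x n1 (n2 + 1)"
      using gen(1,2) by unfold_locales
    let ?a = "A n1 n2" and ?b = "B n1 n2" and ?c = "C n1 n2" and ?a1 = "A (n1 + 1) n2"
      and ?b2 = "B n1 (n2 + 1)" and ?\<alpha> = "A (n1 + 1) (n2 + 1)" and ?\<beta> = "B (n1 + 1) (n2 + 1)"
      and ?c1 = "C (n1 + 1) n2" and ?c2 = "C n1 (n2 + 1)"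
    have x: "x n1 n2 = pt 1 0 0" and x12: "sh1 (sh2 x) n1 n2 = pt ?c ?a1 ?b2"
      by (simp_all add: pt_def sh1_def sh2_def lap)
    \<comment> \<open>The Laplace equation at \<open>(n1 + 1, n2)\<close> cancels the term with
      \<open>x (n1 + 2) n2\<close> in the twice shifted transform, which brings that point into the
      plane.\<close>
    have P: "laplace_pos A x n1 n2 = pt (- ?a) 0 1"
      "sh1 (laplace_pos A x) n1 n2 = pt ?c 0 ?b2"
      "sh1 (sh1 (laplace_pos A x)) n1 n2 = pt (?\<beta> * ?c) (?\<beta> * ?a1 + ?c1) (?\<beta> * ?b2)"
      using lap[of n1 n2] lap[of "n1 + 1" n2]
      unfolding pt_def sh1_def sh2_def laplace_pos_def by (simp_all add: algebra_simps)
    have N: "laplace_neg B x n1 n2 = pt (- ?b) 1 0"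
      "sh2 (laplace_neg B x) n1 n2 = pt ?c ?a1 0"
      "sh2 (sh2 (laplace_neg B x)) n1 n2 = pt (?\<alpha> * ?c) (?\<alpha> * ?a1) (?\<alpha> * ?b2 + ?c2)"
      using lap[of n1 n2] lap[of n1 "n2 + 1"]
      unfolding pt_def sh1_def sh2_def laplace_neg_def by (simp_all add: algebra_simps)
    have "sh1 (sh2 x) n1 n2 \<in> span {x n1 n2, x (n1 + 1) n2, x n1 (n2 + 1)}"
      unfolding x12 span_frame by blast
    then have W: "quad_span x n1 n2 = span {x n1 n2, x (n1 + 1) n2, x n1 (n2 + 1)}"
      using span_redundant[of "sh1 (sh2 x) n1 n2" "{x n1 n2, x (n1 + 1) n2, x n1 (n2 + 1)}"]
      by (simp add: quad_span_def sh1_def[of x] sh2_def[of x] insert_commute)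
    \<comment> \<open>Genericity at the two neighbouring lattice points.\<close>
    have gen': "?\<beta> * ?a1 + ?c1 \<noteq> 0" "?\<alpha> * ?b2 + ?c2 \<noteq> 0"
      using gen(7)[of "n1 + 1" n2] gen(6)[of n1 "n2 + 1"] by simp_all
    \<comment> \<open>The lemma is rewritten instead of the goal because \<open>x n1 n2\<close> also
      occurs in the frame hidden inside \<open>pt\<close>.\<close>
    have "pt 1 0 0 = x n1 n2" using x by (rule sym)
    note lines = lines_concurrent_iff[OF gen(3,4,3,4), unfolded this]
    note conic = conic_through_six_points_iff[OF gen(3-5) gen(3,4,3,4) gen(6,7) gen']
    show ?thesis
      unfolding W P N x12
      by (rule trans[OF conic lines[symmetric]])
  qed
  show ?thesis
    unfolding koenigs_lattice_def iff using assms(3,4) by blast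
qed

end
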